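(* Let $\vartheta$ be a primitive random substitution on a finite alphabet $\mathcal A=\{a_1,\dots,a_n\}$. Then the RS-subshift $X_\vartheta$ is empty if and only if, for every $a_i\in\mathcal A$, the set of realisations of $\vartheta(a_i)$ consists only of words of length $1$.
   Context: Let $\mathcal A=\{a_1,\dots,a_n\}$ be a finite alphabet, $\mathcal A^+$ the set of non-empty finite words over $\mathcal A$, and $\mathcal A^{\mathbb Z}$ the set of bi-infinite sequences. A random substitution (non-degenerate; the probabilities, all non-zero, play no role here and are suppressed) is a map $\vartheta$ assigning to each letter $a_i$ a non-empty finite set $\vartheta(a_i)\subset\mathcal A^+$, whose elements are called the realisations of $\vartheta(a_i)$. A realisation of $\vartheta(u)$, for $u=u_1\cdots u_m\in\mathcal A^+$, is a word $x_1\cdots x_m$ with each $x_j\in\vartheta(u_j)$ chosen independently for each position. Realisations of $\vartheta^k(u)$ are defined inductively: the only realisation of $\vartheta^0(u)$ is $u$, and the realisations of $\vartheta^{k+1}(u)$ are the realisations of $\vartheta(v)$ for $v$ a realisation of $\vartheta^k(u)$. The random substitution $\vartheta$ is primitive if there is $k\in\mathbb N$ such that for all $1\le i,j\le n$ the letter $a_i$ is a subword of some realisation of $\vartheta^k(a_j)$. A word $u\in\mathcal A^+$ is ($\vartheta$-)legal if it is a subword of some realisation of $\vartheta^k(a_j)$ for some $k\in\mathbb N$ and some $j$. The RS-subshift is $X_\vartheta=\{w\in\mathcal A^{\mathbb Z}: \text{every finite non-empty subword of } w \text{ is } \vartheta\text{-legal}\}$. *)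

theory Defs
  imports Main "HOL-Library.Sublist"
begin

text \<open>
  The finite alphabet is a type of class \<open>finite\<close>, finite words are lists, and bi-infinite
  sequences are functions on \<^typ>\<open>int\<close>. A random substitution is represented by the map sending
  a letter to its set of realisations; the probabilities are omitted.
\<close>

definition random_substitution :: "('a \<Rightarrow> 'a list set) \<Rightarrow> bool" where
  "random_substitution \<theta> \<longleftrightarrow> (\<forall>a. finite (\<theta> a) \<and> \<theta> a \<noteq> {} \<and> [] \<notin> \<theta> a)"

text \<open>
  One realisation is chosen for each position of \<open>u\<close>, so different occurrences of the same letter
  may be replaced by different words.
\<close>

definition realisations :: "('a \<Rightarrow> 'a list set) \<Rightarrow> 'a list \<Rightarrow> 'a list set" where
  "realisations \<theta> u = {concat xs | xs. list_all2 (\<lambda>x a. x \<in> \<theta> a) xs u}"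

primrec realisations_pow :: "('a \<Rightarrow> 'a list set) \<Rightarrow> nat \<Rightarrow> 'a list \<Rightarrow> 'a list set" where
  "realisations_pow \<theta> 0 u = {u}"
| "realisations_pow \<theta> (Suc k) u = (\<Union>v\<in>realisations_pow \<theta> k u. realisations \<theta> v)"

text \<open>Subwords are contiguous: this is \<^const>\<open>sublist\<close>, not \<^const>\<open>subseq\<close>.\<close>

definition primitive :: "('a \<Rightarrow> 'a list set) \<Rightarrow> bool" where
  "primitive \<theta> \<longleftrightarrow> (\<exists>k. \<forall>a b. \<exists>v\<in>realisations_pow \<theta> k [b]. sublist [a] v)"

definition legal :: "('a \<Rightarrow> 'a list set) \<Rightarrow> 'a list \<Rightarrow> bool" where
  "legal \<theta> u \<longleftrightarrow> u \<noteq> [] \<and> (\<exists>k b. \<exists>v\<in>realisations_pow \<theta> k [b]. sublist u v)"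

text \<open>The finite non-empty subwords of \<open>w\<close> are the words \<open>w i, \<dots>, w j\<close> with \<open>i \<le> j\<close>.\<close>

definition rs_subshift :: "('a \<Rightarrow> 'a list set) \<Rightarrow> (int \<Rightarrow> 'a) set" where
  "rs_subshift \<theta> = {w. \<forall>i j. i \<le> j \<longrightarrow> legal \<theta> (map w [i..j])}"

end

theory Submission
  imports Defs
begin

text \<open>
  If every realisation is a single letter, then so is every legal word, whereas a point of the
  subshift contains legal words of length two. Otherwise some letter has a realisation of length at
  least two; by primitivity every legal word can be expanded until that letter occurs, so there are
  arbitrarily long legal words, and compactness yields a bi-infinite sequence all of whose subwords
  are legal.
\<close>

section \<open>Bi-infinite sequences from factorial languages\<close>

text \<open>The invariant of the compactness argument: \<open>u\<close> has infinitely many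
  descendants in the tree of two-sided extensions inside \<open>L\<close>. The margins
  \<open>x\<close> and \<open>y\<close> may vary freely with \<open>m\<close>; coherence comes only
  later, from dependent choice.\<close>

definition biextensible :: "('a list \<Rightarrow> bool) \<Rightarrow> 'a list \<Rightarrow> bool" where
  "biextensible L u \<longleftrightarrow> (\<forall>m. \<exists>x y. length x = m \<and> length y = m \<and> L (x @ u @ y))"

text \<open>The pigeonhole step of Koenig's lemma: if each of the finitely many pairs
  \<open>(a, b)\<close> failed at some margin length, then an extension of \<open>u\<close> by one
  letter more than the largest of these lengths could not exist.\<close>

lemma biextensible_step:
  fixes L :: "'a::finite list \<Rightarrow> bool"
  assumes factorial: "\<And>u v. L v \<Longrightarrow> sublist u v \<Longrightarrow> L u"
    and u: "biextensible L u"
  shows "\<exists>a b. biextensible L (a # u @ [b])"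
proof (rule ccontr)
  assume "\<not> ?thesis"
  then have "\<forall>p. \<exists>m. \<forall>x y. length x = m \<and> length y = m \<longrightarrow> \<not> L (x @ (fst p # u @ [snd p]) @ y)"
    by (simp add: biextensible_def) blast
  then obtain M where
    M: "\<And>p x y. length x = M p \<Longrightarrow> length y = M p \<Longrightarrow> \<not> L (x @ (fst p # u @ [snd p]) @ y)"
    by metis
  define m where "m = Max (range M)"
  have M_le: "M p \<le> m" for p
    unfolding m_def by (rule Max_ge) auto
  \<comment> \<open>One letter on each side is spent on the pair \<open>(a, b)\<close>; margins of
    length \<open>m\<close> remain.\<close>
  obtain x y where xy: "length x = Suc m" "length y = Suc m" "L (x @ u @ y)"
    using u unfolding biextensible_def by blast
  obtain x' a where x: "x = x' @ [a]" and "length x' = m"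
    using xy(1) by (metis length_Suc_conv_rev)
  obtain b y' where y: "y = b # y'" and "length y' = m"
    using xy(2) by (metis length_Suc_conv)
  let ?k = "M (a, b)"
  \<comment> \<open>Trimming the outer ends leaves margins of exactly the length at which the pair
    \<open>(a, b)\<close> fails.\<close>
  let ?x = "drop (m - ?k) x'" and ?y = "take ?k y'"
  have "x @ u @ y = take (m - ?k) x' @ (?x @ (a # u @ [b]) @ ?y) @ drop ?k y'"
    by (simp add: x y)
  then have "sublist (?x @ (a # u @ [b]) @ ?y) (x @ u @ y)"
    by (metis sublist_appendI)
  then have "L (?x @ (a # u @ [b]) @ ?y)"
    using factorial xy(3) by blast
  moreover have "length ?x = ?k" "length ?y = ?k"
    using M_le[of "(a, b)"] \<open>length x' = m\<close> \<open>length y' = m\<close> by auto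
  ultimately show False
    using M[of ?x "(a, b)" ?y] by simp
qed

lemma sublist_upto:
  assumes "i' \<le> i" "i \<le> j" "j \<le> j'"
  shows "sublist [i..j] [i'..j']"
proof -
  have "[i'..j'] = [i'..i - 1] @ [i..j] @ [j + 1..j']"
    using assms upto_split1[of i' i j'] upto_split2[of i j j'] by simp
  then show ?thesis
    by (metis sublist_appendI)
qed

text \<open>Starting from the empty word, \<open>biextensible_step\<close> gives words that grow by
  one letter at each end. Their union is the sequence, and every finite window of it lies in one of
  them.\<close>

lemma ex_biinfinite_sequence:
  fixes L :: "'a::finite list \<Rightarrow> bool"
  assumes factorial: "\<And>u v. L v \<Longrightarrow> sublist u v \<Longrightarrow> L u"
    and unbounded: "\<And>n. \<exists>v. L v \<and> n \<le> length v"
  shows "\<exists>w :: int \<Rightarrow> 'a. \<forall>i j. i \<le> j \<longrightarrow> L (map w [i..j])"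
proof -
  have "biextensible L []"
    unfolding biextensible_def
  proof
    fix m
    obtain v where v: "L v" "m + m \<le> length v"
      using unbounded by blast
    have "L (take m v @ [] @ take m (drop m v))"
      using factorial[OF v(1), of "take (m + m) v"] by (simp add: take_add[symmetric] sublist_take)
    then show "\<exists>x y. length x = m \<and> length y = m \<and> L (x @ [] @ y)"
      using v(2) by (intro exI[of _ "take m v"] exI[of _ "take m (drop m v)"]) auto
  qed
  then have "\<exists>f. \<forall>n. (biextensible L (f n) \<and> length (f n) = 2 * n) \<and>
      (\<exists>a b. f (Suc n) = a # f n @ [b])"
  proof (intro dependent_nat_choice)
    fix u n
    assume "biextensible L u \<and> length u = 2 * n"
    then obtain a b where "biextensible L (a # u @ [b])" "length u = 2 * n"
      using biextensible_step[of L u] factorial by blast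
    then show "\<exists>v. (biextensible L v \<and> length v = 2 * Suc n) \<and> (\<exists>a b. v = a # u @ [b])"
      by (intro exI[of _ "a # u @ [b]"]) auto
  qed auto
  then obtain f where f: "\<And>n. biextensible L (f n)" "\<And>n. length (f n) = 2 * n"
    "\<And>n. \<exists>a b. f (Suc n) = a # f n @ [b]"
    by blast
  \<comment> \<open>The word \<open>f n\<close> is to occupy the positions from \<open>-n\<close> to
    \<open>n - 1\<close>. So the letter at \<open>i \<ge> 0\<close> is the last one of
    \<open>f (i + 1)\<close>, and the letter at \<open>i < 0\<close> is the first one of
    \<open>f (-i)\<close>.\<close>
  define w :: "int \<Rightarrow> 'a" where
    "w i = (if 0 \<le> i then last (f (Suc (nat i))) else hd (f (nat (- i))))" for i
  have f_eq: "f n = map w [- int n..int n - 1]" for n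
  proof (induction n)
    case 0
    then show ?case using f(2)[of 0] by simp
  next
    case (Suc n)
    obtain a b where ab: "f (Suc n) = a # f n @ [b]"
      using f(3) by blast
    have "w (int n) = b"
      by (simp add: w_def ab)
    moreover have "nat (1 + int n) = Suc n"
      by simp
    then have "w (- int n - 1) = a"
      by (simp add: w_def ab)
    moreover have "[- int n - 1..int n] = (- int n - 1) # [- int n..int n - 1] @ [int n]"
      using upto_rec1[of "- int n - 1" "int n"] upto_rec2[of "- int n" "int n"] by simp
    moreover have "- int (Suc n) = - int n - 1" "int (Suc n) - 1 = int n"
      by simp_all
    ultimately show ?case
      using ab Suc by (simp only: list.map map_append)
  qed
  have "L (map w [i..j])" if "i \<le> j" for i j
  proof -
    \<comment> \<open>The successor is due to the right end of the window of \<open>f n\<close>,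
      which is \<open>n - 1\<close>.\<close>
    define n where "n = Suc (nat (max \<bar>i\<bar> \<bar>j\<bar>))"
    have "L (f n)"
      using f(1)[of n] unfolding biextensible_def by (metis append_Nil append_Nil2 length_0_conv)
    moreover have "sublist [i..j] [- int n..int n - 1]"
      by (rule sublist_upto) (use that in \<open>auto simp: n_def\<close>)
    then have "sublist (map w [i..j]) (f n)"
      unfolding f_eq by (rule map_mono_sublist)
    ultimately show ?thesis
      using factorial by blast
  qed
  then show ?thesis by blast
qed

section \<open>Realisations\<close>

lemma realisations_append:
  assumes "x \<in> realisations \<theta> u" "y \<in> realisations \<theta> v"
  shows "x @ y \<in> realisations \<theta> (u @ v)"
proof -
  obtain xs ys where "x = concat xs" "list_all2 (\<lambda>x a. x \<in> \<theta> a) xs u"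
    "y = concat ys" "list_all2 (\<lambda>x a. x \<in> \<theta> a) ys v"
    using assms by (auto simp: realisations_def)
  then show ?thesis
    unfolding realisations_def by (auto intro!: exI[of _ "xs @ ys"] list_all2_appendI)
qed

lemma realisations_singleton: "realisations \<theta> [a] = \<theta> a"
proof -
  have "x \<in> realisations \<theta> [a]" if "x \<in> \<theta> a" for x
    unfolding realisations_def using that by (auto intro!: exI[of _ "[x]"])
  then show ?thesis
    by (auto simp: realisations_def list_all2_Cons2)
qed

lemma realisations_pow_append:
  assumes "x \<in> realisations_pow \<theta> k u" "y \<in> realisations_pow \<theta> k v"
  shows "x @ y \<in> realisations_pow \<theta> k (u @ v)"
  using assms
proof (induction k arbitrary: x y)
  case (Suc k)
  then show ?case
    by simp (meson realisations_append)
qed simp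

lemma realisations_pow_trans:
  assumes "v \<in> realisations_pow \<theta> k u" "w \<in> realisations_pow \<theta> l v"
  shows "w \<in> realisations_pow \<theta> (k + l) u"
  using assms by (induction l arbitrary: w) auto

text \<open>Every letter has a realisation and none is empty, so replacing the letters one by one
  cannot shorten the word.\<close>

lemma ex_realisation_length_ge:
  assumes "random_substitution \<theta>"
  shows "\<exists>v\<in>realisations \<theta> u. length u \<le> length v"
proof (induction u)
  case (Cons a u)
  obtain x where "x \<in> \<theta> a" "x \<noteq> []"
    using assms unfolding random_substitution_def by blast
  moreover obtain v where "v \<in> realisations \<theta> u" "length u \<le> length v"
    using Cons by blast
  ultimately have "x @ v \<in> realisations \<theta> (a # u)"
    using realisations_append[of x \<theta> "[a]" v u] by (simp add: realisations_singleton)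
  moreover have "length (a # u) \<le> length (x @ v)"
    using \<open>length u \<le> length v\<close> \<open>x \<noteq> []\<close> by (cases x) auto
  ultimately show ?case by blast
qed (simp add: realisations_def)

lemma ex_realisation_pow_length_ge:
  assumes "random_substitution \<theta>"
  shows "\<exists>v\<in>realisations_pow \<theta> k u. length u \<le> length v"
proof (induction k)
  case (Suc k)
  then show ?case
    using ex_realisation_length_ge[OF assms] by simp (meson order_trans)
qed simp

lemma length_realisation_single_letters:
  assumes "\<forall>a. \<forall>u\<in>\<theta> a. length u = 1" "v \<in> realisations \<theta> u"
  shows "length v = length u"
proof -
  obtain xs where "list_all2 (\<lambda>x a. x \<in> \<theta> a) xs u" "v = concat xs"
    using assms(2) by (auto simp: realisations_def)
  then show ?thesis
    by (induction arbitrary: v rule: list_all2_induct) (use assms(1) in auto)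
qed

lemma length_realisation_pow_single_letters:
  assumes "\<forall>a. \<forall>u\<in>\<theta> a. length u = 1" "v \<in> realisations_pow \<theta> k u"
  shows "length v = length u"
  using assms(2)
  by (induction k arbitrary: v) (auto dest!: length_realisation_single_letters[OF assms(1)])

text \<open>Expand the first letter of \<open>u\<close> until \<open>a\<close> occurs, then replace
  that occurrence by \<open>z\<close>, which has at least two letters; everything else can be
  realised without loss of length.\<close>

lemma ex_longer_realisation_pow:
  assumes \<theta>: "random_substitution \<theta>" and "primitive \<theta>"
    and z: "z \<in> \<theta> a" "length z \<noteq> 1" and "u \<noteq> []"
  shows "\<exists>k. \<exists>v\<in>realisations_pow \<theta> k u. length u < length v"
proof -
  obtain k where k: "\<And>a b. \<exists>v\<in>realisations_pow \<theta> k [b]. sublist [a] v"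
    using \<open>primitive \<theta>\<close> unfolding primitive_def by blast
  obtain c u' where u: "u = c # u'"
    using \<open>u \<noteq> []\<close> by (cases u) auto
  obtain p q where pq: "p @ [a] @ q \<in> realisations_pow \<theta> k [c]"
    using k[of c a] by (auto simp: sublist_def)
  \<comment> \<open>The rest \<open>u'\<close> has to pass through the same number \<open>k\<close>
    of substitutions as \<open>c\<close>.\<close>
  obtain r where r: "r \<in> realisations_pow \<theta> k u'" "length u' \<le> length r"
    using ex_realisation_pow_length_ge[OF \<theta>] by blast
  obtain p' where p': "p' \<in> realisations \<theta> p" "length p \<le> length p'"
    using ex_realisation_length_ge[OF \<theta>] by blast
  obtain q' where q': "q' \<in> realisations \<theta> (q @ r)" "length (q @ r) \<le> length q'"
    using ex_realisation_length_ge[OF \<theta>] by blast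
  have "z \<in> realisations \<theta> [a]"
    using z by (simp add: realisations_singleton)
  then have "p' @ z @ q' \<in> realisations \<theta> (p @ [a] @ q @ r)"
    using p' q' by (intro realisations_append)
  moreover have "p @ [a] @ q @ r \<in> realisations_pow \<theta> k u"
    using realisations_pow_append[OF pq r(1)] by (simp add: u)
  ultimately have "p' @ z @ q' \<in> realisations_pow \<theta> (Suc k) u"
    by auto
  moreover have "length z \<noteq> 0"
    using \<theta> z unfolding random_substitution_def by auto
  then have "1 < length z"
    using z(2) by linarith
  then have "length u < length (p' @ z @ q')"
    using r(2) q'(2) by (simp add: u)
  ultimately show ?thesis by blast
qed

text \<open>Each use of \<open>ex_longer_realisation_pow\<close> adds at least one letter, and
  exponents add up under composition.\<close>

lemma ex_realisation_pow_length_unbounded: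
  assumes "random_substitution \<theta>" "primitive \<theta>" "z \<in> \<theta> a" "length z \<noteq> 1"
  shows "\<exists>k. \<exists>v\<in>realisations_pow \<theta> k [b]. n < length v"
proof (induction n)
  case 0
  show ?case
    by (rule exI[of _ 0]) simp
next
  case (Suc n)
  then obtain k v where v: "v \<in> realisations_pow \<theta> k [b]" "n < length v"
    by blast
  then obtain l w where "w \<in> realisations_pow \<theta> l v" "length v < length w"
    using ex_longer_realisation_pow[OF assms, of v] by fastforce
  then show ?case
    using v realisations_pow_trans[OF v(1), of w l] by (intro exI[of _ "k + l"] bexI[of _ w]) auto
qed

theorem proposition8:
  fixes \<theta> :: "'a::finite \<Rightarrow> 'a list set"
  assumes "random_substitution \<theta>"
    and "primitive \<theta>"
  shows "rs_subshift \<theta> = {} \<longleftrightarrow> (\<forall>a. \<forall>u\<in>\<theta> a. length u = 1)"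
proof
  assume empty: "rs_subshift \<theta> = {}"
  show "\<forall>a. \<forall>u\<in>\<theta> a. length u = 1"
  proof (rule ccontr)
    assume "\<not> ?thesis"
    then obtain a z where z: "z \<in> \<theta> a" "length z \<noteq> 1"
      by blast
    define L where "L u \<longleftrightarrow> (\<exists>k b. \<exists>v\<in>realisations_pow \<theta> k [b]. sublist u v)" for u
    have "L u" if "L v" "sublist u v" for u v
      using that unfolding L_def by (meson sublist_order.order_trans)
    moreover have "\<exists>v. L v \<and> n \<le> length v" for n
      \<comment> \<open>Any letter can serve as the start; \<open>undefined\<close> is an arbitrary
        one.\<close>
      using ex_realisation_pow_length_unbounded[OF assms z, of undefined n] unfolding L_def
      by (meson less_imp_le sublist_order.order_refl)
    ultimately obtain w where "\<And>i j. i \<le> j \<Longrightarrow> L (map w [i..j])"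
      using ex_biinfinite_sequence[of L] by blast
    then have "w \<in> rs_subshift \<theta>"
      by (simp add: rs_subshift_def legal_def L_def)
    with empty show False by blast
  qed
next
  assume single: "\<forall>a. \<forall>u\<in>\<theta> a. length u = 1"
  have "length u \<le> 1" if "legal \<theta> u" for u
    using that length_realisation_pow_single_letters[OF single]
    unfolding legal_def by (fastforce dest: sublist_length_le)
  \<comment> \<open>A window of two letters contradicts the length bound.\<close>
  moreover have "legal \<theta> (map w [0..1])" if "w \<in> rs_subshift \<theta>" for w
    using that by (simp add: rs_subshift_def)
  ultimately show "rs_subshift \<theta> = {}"
    by fastforce
qed

end
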